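(* Let $L_n$ be the Lucas numbers, extended to all integer indices. For every non-zero integer $n$, \[ \tan^{-1}\left(\frac{2}{L_{2n-1}}\right) = 2\tan^{-1}\left(\frac{1}{L_{2n}}\right)+\tan^{-1}\left(\frac{2}{L_{2n+1}}\right). \]
   Context: The Fibonacci numbers are defined by $F_0=0$, $F_1=1$, $F_n=F_{n-1}+F_{n-2}$, and extended to all integers by the same recurrence. The Lucas numbers are $L_n=F_{n-1}+F_{n+1}$, so that $L_0=2$, $L_1=1$, $L_n=L_{n-1}+L_{n-2}$ for all integers $n$. $\tan^{-1}$ denotes the principal branch of the arctangent, with values in $(-\pi/2,\pi/2)$. *)

theory Defs
  imports Complex_Main "HOL-Number_Theory.Fib"
begin

text \<open>
  The library function \<^const>\<open>fib\<close> only covers natural indices. For negative indices the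
  recurrence is run backwards: \<open>F n = F (n + 2) - F (n + 1)\<close>.
\<close>

function fib_int :: "int \<Rightarrow> int" where
  "fib_int n =
     (if n = 0 then 0
      else if n = 1 then 1
      else if n > 1 then fib_int (n - 1) + fib_int (n - 2)
      else fib_int (n + 2) - fib_int (n + 1))"
  by auto
termination
  by (relation "measure (\<lambda>n. nat (if n \<ge> 0 then n else 1 - n))") auto

declare fib_int.simps [simp del]

lemma fib_int_0: "fib_int 0 = 0"
  by (simp add: fib_int.simps)

lemma fib_int_1: "fib_int 1 = 1"
  by (simp add: fib_int.simps)

lemma fib_int_rec: "fib_int n = fib_int (n - 1) + fib_int (n - 2)"
proof (cases "n > 1")
  case True
  then show ?thesis by (subst fib_int.simps) simp
next
  case False
  then have "fib_int (n - 2) = fib_int (n - 2 + 2) - fib_int (n - 2 + 1)"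
    by (subst fib_int.simps) simp
  then show ?thesis by simp
qed

lemma fib_int_of_nat: "fib_int (int n) = int (fib n)"
proof (induction n rule: fib.induct)
  case (3 n)
  then show ?case
    using fib_int_rec [of "int (Suc (Suc n))"] by (simp add: algebra_simps)
qed (simp_all add: fib_int_0 fib_int_1)

definition lucas :: "int \<Rightarrow> int" where
  "lucas n = fib_int (n - 1) + fib_int (n + 1)"

lemma lucas_0: "lucas 0 = 2"
  using fib_int_rec [of 1] by (simp add: lucas_def fib_int_0 fib_int_1)

lemma lucas_1: "lucas 1 = 1"
  using fib_int_rec [of 2] by (simp add: lucas_def fib_int_0 fib_int_1)

lemma lucas_rec: "lucas n = lucas (n - 1) + lucas (n - 2)"
  using fib_int_rec [of "n - 1"] fib_int_rec [of "n + 1"]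
  by (simp add: lucas_def)

end

theory Submission imports Defs begin

text \<open>
  Cassini's identity gives \<open>L\<^bsub>2n-1\<^esub> L\<^bsub>2n+1\<^esub> = L\<^bsub>2n\<^esub>\<^sup>2 - 5\<close>, and \<open>L\<^bsub>2n\<^esub> \<ge> 3\<close> for \<open>n \<noteq> 0\<close>. Hence the two
  odd-indexed Lucas numbers have the same sign, so the subtraction formula for the arctangent
  needs no correction by \<open>\<pi>\<close>, and with \<open>b = L\<^bsub>2n\<^esub>\<close> the difference of the outer terms is
  \<open>arctan (2b / (b\<^sup>2 - 1)) = 2 arctan (1/b)\<close>.
\<close>

text \<open>Both arctangents lie in the same half of the principal range, so their difference stays
  where \<open>arctan\<close> inverts \<open>tan\<close>.\<close>

lemma arctan_diff_same_sign:
  fixes x y :: real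
  assumes "x * y > 0"
  shows "arctan x - arctan y = arctan ((x - y) / (1 + x * y))"
proof -
  have range: "- (pi / 2) < arctan x - arctan y" "arctan x - arctan y < pi / 2"
  proof -
    have "x > 0 \<and> y > 0 \<or> x < 0 \<and> y < 0"
      using assms by (simp add: zero_less_mult_iff)
    then have "arctan x > 0 \<and> arctan y > 0 \<or> arctan x < 0 \<and> arctan y < 0"
      by simp
    then show "- (pi / 2) < arctan x - arctan y" "arctan x - arctan y < pi / 2"
      using arctan_bounded[of x] arctan_bounded[of y] by linarith+
  qed
  then have "cos (arctan x - arctan y) \<noteq> 0"
    using cos_gt_zero_pi by fastforce
  then have "tan (arctan x - arctan y) = (x - y) / (1 + x * y)"
    by (simp add: tan_diff tan_arctan)
  with range show ?thesis
    by (metis arctan_unique)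
qed

lemma lucas_forward: "lucas (n + 2) = lucas n + lucas (n + 1)"
  using lucas_rec[of "n + 2"] by (simp add: algebra_simps)

text \<open>Raising the middle index by one flips the sign of the Cassini difference, so moving by
  two preserves its value -5 at index 0, in both directions.\<close>

lemma lucas_cassini_even: "lucas (2 * n - 1) * lucas (2 * n + 1) = lucas (2 * n) ^ 2 - 5"
proof (induction n rule: int_induct[where k = 0])
  case base
  show ?case
    using lucas_forward[of "-1"] by (simp add: lucas_0 lucas_1)
next
  case (step1 i)
  then show ?case
    using lucas_forward[of "2 * i - 1"] lucas_forward[of "2 * i"] lucas_forward[of "2 * i + 1"]
    by (simp add: algebra_simps power2_eq_square)
next
  case (step2 i)
  then show ?case
    using lucas_forward[of "2 * i - 1"] lucas_forward[of "2 * i - 2"] lucas_forward[of "2 * i - 3"]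
    by (simp add: algebra_simps power2_eq_square)
qed

lemma lucas_even_ge_3:
  assumes "n \<noteq> 0"
  shows "lucas (2 * n) \<ge> 3"
proof (cases "n > 0")
  case True
  then have "1 \<le> n" by simp
  \<comment> \<open>The sign of the odd neighbour farther from 0 is carried along so that the even
    values cannot decrease.\<close>
  then have "lucas (2 * n) \<ge> 3 \<and> lucas (2 * n + 1) \<ge> 0"
  proof (induction n rule: int_ge_induct)
    case base
    show ?case
      using lucas_forward[of 0] lucas_forward[of 1] by (simp add: lucas_0 lucas_1)
  next
    case (step i)
    then show ?case
      using lucas_forward[of "2 * i"] lucas_forward[of "2 * i + 1"] by (simp add: algebra_simps)
  qed
  then show ?thesis ..
next
  case False
  with assms have "n \<le> - 1" by simp
  \<comment> \<open>Going down, the recurrence subtracts the odd neighbour, so here it must be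
    nonpositive.\<close>
  then have "lucas (2 * n) \<ge> 3 \<and> lucas (2 * n - 1) \<le> 0"
  proof (induction n rule: int_le_induct)
    case base
    show ?case
      using lucas_forward[of "-1"] lucas_forward[of "-2"] lucas_forward[of "-3"]
      by (simp add: lucas_0 lucas_1)
  next
    case (step i)
    then show ?case
      using lucas_forward[of "2 * i - 2"] lucas_forward[of "2 * i - 3"]
      by (simp add: algebra_simps)
  qed
  then show ?thesis ..
qed

theorem theorem7:
  fixes n :: int
  assumes "n \<noteq> 0"
  shows "arctan (2 / real_of_int (lucas (2 * n - 1))) =
         2 * arctan (1 / real_of_int (lucas (2 * n))) +
         arctan (2 / real_of_int (lucas (2 * n + 1)))"
proof -
  define a b c where "a = real_of_int (lucas (2 * n - 1))"
    and "b = real_of_int (lucas (2 * n))" and "c = real_of_int (lucas (2 * n + 1))"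
  have c: "c = a + b"
    using lucas_forward[of "2 * n - 1"] by (simp add: a_def b_def c_def algebra_simps)
  have b: "b \<ge> 3"
    using lucas_even_ge_3[OF assms] by (simp add: b_def)
  have "a * c = real_of_int (lucas (2 * n - 1) * lucas (2 * n + 1))"
    by (simp add: a_def c_def)
  then have ac: "a * c = b\<^sup>2 - 5"
    unfolding lucas_cassini_even by (simp add: b_def)
  have "b\<^sup>2 \<ge> 3\<^sup>2"
    using b by (intro power_mono) auto
  then have b2: "b\<^sup>2 \<ge> 9" by simp
  with ac have pos: "a * c > 0" by simp
  then have nz: "a \<noteq> 0" "c \<noteq> 0" by auto
  have "arctan (2 / a) - arctan (2 / c) = arctan ((2 / a - 2 / c) / (1 + 2 / a * (2 / c)))"
    using pos by (intro arctan_diff_same_sign) simp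
  also have "(2 / a - 2 / c) / (1 + 2 / a * (2 / c)) = 2 * (c - a) / (a * c + 4)"
  proof -
    have "2 / a - 2 / c = 2 * (c - a) / (a * c)" "1 + 2 / a * (2 / c) = (a * c + 4) / (a * c)"
      using nz by (simp_all add: field_simps)
    then show ?thesis using nz by simp
  qed
  also have "\<dots> = 2 * b / (b\<^sup>2 - 1)"
    unfolding ac by (simp add: c)
  \<comment> \<open>This is the double-angle form of the tangent at
    \<open>arctan (1 / b)\<close>.\<close>
  also have "\<dots> = 2 * (1 / b) / (1 - (1 / b)\<^sup>2)"
  proof -
    have "1 - (1 / b)\<^sup>2 = (b\<^sup>2 - 1) / b\<^sup>2"
      using b by (simp add: field_simps)
    then show ?thesis using b by (simp add: power2_eq_square)
  qed
  \<comment> \<open>The doubling formula needs the absolute value of \<open>1 / b\<close> below 1,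
    which \<open>b\<close> \<ge> 3 ensures.\<close>
  also have "arctan \<dots> = 2 * arctan (1 / b)"
    using b by (intro arctan_double[symmetric]) simp
  finally show ?thesis
    by (simp add: a_def b_def c_def)
qed

end
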